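(* Let $n$ be a positive integer such that $n=p$ for a prime $p$; or $n=4$; or $n=pq$ is a product of two distinct primes $p$ and $q$. Then the equation $$x^4+y^4+z^4-2x^2y^2-2y^2z^2-2z^2x^2=n$$ has no integer solutions $(x,y,z)$. *)

theory Defs
  imports Complex_Main "HOL-Computational_Algebra.Primes"
begin

end

theory Submission
  imports Defs
begin

text \<open>
  The form is Heron's polynomial: it equals
  \<open>(x + y + z) (x + y - z) (x - y + z) (x - y - z)\<close>. It is symmetric and even in each
  variable, so assume \<open>x \<ge> y, z \<ge> 0\<close>. Then the first three factors are nonnegative, and a
  positive value forces \<open>d = x - y - z > 0\<close>; in terms of \<open>d\<close> the value is
  \<open>d (d + 2y) (d + 2z) (d + 2y + 2z)\<close>.

  If \<open>y\<close> and \<open>z\<close> are both positive, the last three factors exceed 1, whereas \<open>n\<close> has at most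
  two prime factors counted with multiplicity. If one of \<open>y\<close> and \<open>z\<close> vanishes, the value is the square
  of \<open>d (d + 2y)\<close> or of \<open>d (d + 2z)\<close>. Neither a prime nor a product of two distinct primes is a
  square, and \<open>4\<close> is excluded by parity: \<open>d (d + 2y) = 2\<close> is impossible because both factors
  have the same parity. The lemma \<open>heron_product_excluded\<close> is this arithmetic half of the argument,
  and \<open>heron_dominant_neq\<close> joins it to the factorization.
\<close>

lemma no_three_factors_if_at_most_two_prime_factors:
  fixes a b c :: nat
  assumes "size (prime_factorization (a * b * c)) \<le> 2" "a > 1" "b > 1" "c > 1"
  shows False
proof -
  have pos: "size (prime_factorization k) \<ge> 1" if "k > 1" for k :: nat
    using that by (simp add: Suc_le_eq nonempty_has_size[symmetric] prime_factorization_empty_iff)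
  have "size (prime_factorization (a * b * c)) =
      size (prime_factorization a) + size (prime_factorization b) + size (prime_factorization c)"
    using assms by (simp add: prime_factorization_mult)
  with pos[of a] pos[of b] pos[of c] assms show False by linarith
qed

lemma prime_mult_distinct_prime_not_square:
  fixes p q m :: nat
  assumes "prime p" "prime q" "p \<noteq> q"
  shows "p * q \<noteq> m ^ 2"
proof
  assume eq: "p * q = m ^ 2"
  then have "p dvd m" using assms(1) by (metis dvd_triv_left prime_dvd_power)
  then obtain k where "m = p * k" by (elim dvdE)
  with eq have "q = p * k ^ 2"
    using assms(1) by (auto simp: power2_eq_square dest: prime_gt_0_nat)
  then show False using assms by (metis dvd_triv_left primes_dvd_imp_eq)
qed

text \<open>The factors have the same parity, so their product is odd or divisible by 4.\<close>
lemma mult_same_parity_neq_2: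
  fixes d y :: nat
  shows "d * (d + 2 * y) \<noteq> 2"
proof
  assume eq: "d * (d + 2 * y) = 2"
  have "even d" using arg_cong[OF eq, of even] by simp
  then obtain e where "d = 2 * e" by (elim evenE)
  with eq have "2 * (e * (e + y)) = 1" by (simp add: algebra_simps)
  then show False by presburger
qed

text \<open>
  The degenerate case: with one of the variables zero, Heron's polynomial is a square, and the
  root is a product of two numbers of equal parity.
\<close>
lemma square_of_same_parity_product_excluded:
  fixes n d y :: nat
  assumes "prime n \<or> n = 4 \<or> (\<exists>p q :: nat. prime p \<and> prime q \<and> p \<noteq> q \<and> n = p * q)"
  shows "n \<noteq> (d * (d + 2 * y)) ^ 2"
  using assms
proof (elim disjE exE conjE)
  assume "prime n"
  then show ?thesis using prime_power_iff[of _ 2] by auto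
next
  assume "n = 4"
  show ?thesis
  proof
    assume "n = (d * (d + 2 * y)) ^ 2"
    with \<open>n = 4\<close> have "(d * (d + 2 * y)) ^ 2 = 2 ^ 2" by simp
    then have "d * (d + 2 * y) = 2" by (simp only: power_eq_iff_eq_base zero_less_numeral zero_le)
    then show False using mult_same_parity_neq_2 by blast
  qed
next
  fix p q :: nat
  assume "prime p" "prime q" "p \<noteq> q" "n = p * q"
  then show ?thesis by (simp only: prime_mult_distinct_prime_not_square not_False_eq_True)
qed

lemma heron_product_excluded:
  fixes n d y z :: nat
  assumes n: "prime n \<or> n = 4 \<or> (\<exists>p q :: nat. prime p \<and> prime q \<and> p \<noteq> q \<and> n = p * q)"
    and "d > 0"
  shows "n \<noteq> d * (d + 2 * y) * (d + 2 * z) * (d + 2 * y + 2 * z)"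
proof
  assume eq: "n = d * (d + 2 * y) * (d + 2 * z) * (d + 2 * y + 2 * z)"
  consider "y = 0" | "z = 0" | "y > 0" "z > 0" by blast
  then show False
  proof cases
    case 1
    then have "n = (d * (d + 2 * z)) ^ 2" using eq by (simp add: power2_eq_square ac_simps)
    then show False using square_of_same_parity_product_excluded[OF n] by blast
  next
    case 2
    then have "n = (d * (d + 2 * y)) ^ 2" using eq by (simp add: power2_eq_square ac_simps)
    then show False using square_of_same_parity_product_excluded[OF n] by blast
  next
    case 3
    have "prime_factorization 4 = {#2, 2 :: nat#}"
      using prime_factorization_mult[of 2 "2 :: nat"] by (simp add: prime_factorization_prime)
    then have "size (prime_factorization n) \<le> 2"
      using n by (auto simp: prime_factorization_prime prime_factorization_mult)
    \<comment> \<open>The factor \<open>d\<close> may be 1, so it is absorbed into a neighbour.\<close>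
    then have "size (prime_factorization ((d * (d + 2 * y)) * (d + 2 * z) * (d + 2 * y + 2 * z))) \<le> 2"
      unfolding eq .
    moreover have "d * (d + 2 * y) > 1"
    proof -
      have "1 < d + 2 * y" using 3 by simp
      also have "\<dots> \<le> d * (d + 2 * y)" using \<open>d > 0\<close> by (cases d) simp_all
      finally show ?thesis .
    qed
    moreover have "d + 2 * z > 1" "d + 2 * y + 2 * z > 1" using 3 \<open>d > 0\<close> by simp_all
    ultimately show False by (rule no_three_factors_if_at_most_two_prime_factors)
  qed
qed

text \<open>
  This is \<open>-16 A^2\<close>, where \<open>A\<close> is the area of a triangle with sides \<open>x\<close>, \<open>y\<close>, \<open>z\<close>; a positive value
  thus says that no such triangle exists.
\<close>
definition heron :: "int \<Rightarrow> int \<Rightarrow> int \<Rightarrow> int" where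
  "heron x y z = x^4 + y^4 + z^4 - 2 * x^2 * y^2 - 2 * y^2 * z^2 - 2 * z^2 * x^2"

lemma heron_factorization:
  "heron x y z = (x + y + z) * (x + y - z) * (x - y + z) * (x - y - z)"
proof -
  have "heron x y z = (x^2 - y^2)^2 - z^2 * ((x + y)^2 + (x - y)^2) + (z^2)^2"
    unfolding heron_def by (simp add: power2_sum power2_diff algebra_simps flip: power_mult)
  also have "\<dots> = ((x + y)^2 - z^2) * ((x - y)^2 - z^2)"
    by (simp add: power2_sum power2_diff power2_eq_square algebra_simps)
  also have "\<dots> = ((x + y + z) * (x + y - z)) * ((x - y + z) * (x - y - z))"
    by (simp only: power2_eq_square square_diff_square_factored)
  finally show ?thesis by (simp only: mult.assoc)
qed

text \<open>
  When \<open>x\<close> is the largest variable, \<open>x - y - z\<close> is the only linear factor that can be negative, so it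
  carries the sign of the whole product.
\<close>
lemma heron_positive_dominant_imp_triangle_inequality_fails:
  assumes "0 \<le> y" "y \<le> x" "0 \<le> z" "z \<le> x" "heron x y z > 0"
  shows "x > y + z"
proof (rule ccontr)
  assume "\<not> x > y + z"
  then have "(x + y + z) * (x + y - z) * (x - y + z) * (x - y - z) \<le> 0"
    using assms by (intro mult_nonneg_nonpos mult_nonneg_nonneg) auto
  with assms show False by (simp add: heron_factorization)
qed

lemma heron_dominant_neq:
  fixes n :: nat
  assumes n: "prime n \<or> n = 4 \<or> (\<exists>p q :: nat. prime p \<and> prime q \<and> p \<noteq> q \<and> n = p * q)"
    and "n > 0" and le: "0 \<le> y" "y \<le> x" "0 \<le> z" "z \<le> x"
  shows "heron x y z \<noteq> int n"
proof
  assume eq: "heron x y z = int n"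
  with \<open>n > 0\<close> le have less: "x > y + z"
    by (intro heron_positive_dominant_imp_triangle_inequality_fails) auto
  define d where "d = nat (x - y - z)"
  define y' z' where "y' = nat y" and "z' = nat z"
  have factors: "x + y + z = int (d + 2 * y' + 2 * z')" "x + y - z = int (d + 2 * y')"
      "x - y + z = int (d + 2 * z')" "x - y - z = int d"
    using less le by (auto simp: d_def y'_def z'_def)
  have "int n = int (d * (d + 2 * y') * (d + 2 * z') * (d + 2 * y' + 2 * z'))"
    unfolding eq[symmetric] heron_factorization factors of_nat_mult by (simp only: ac_simps)
  then have "n = d * (d + 2 * y') * (d + 2 * z') * (d + 2 * y' + 2 * z')"
    by (simp only: of_nat_eq_iff)
  moreover have "d > 0" using less by (simp add: d_def)
  ultimately show False using heron_product_excluded[OF n] by blast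
qed

theorem theorem4:
  fixes n :: nat
  assumes "n > 0"
    and "prime n \<or> n = 4 \<or> (\<exists>p q :: nat. prime p \<and> prime q \<and> p \<noteq> q \<and> n = p * q)"
  shows "\<nexists>x y z :: int.
    x^4 + y^4 + z^4 - 2 * x^2 * y^2 - 2 * y^2 * z^2 - 2 * z^2 * x^2 = int n"
proof (intro notI, elim exE)
  fix x y z :: int
  assume "x^4 + y^4 + z^4 - 2 * x^2 * y^2 - 2 * y^2 * z^2 - 2 * z^2 * x^2 = int n"
  then have abs: "heron \<bar>x\<bar> \<bar>y\<bar> \<bar>z\<bar> = int n" by (simp add: heron_def)
  \<comment> \<open>By symmetry, a variable of largest absolute value can be put first.\<close>
  then have "heron \<bar>y\<bar> \<bar>z\<bar> \<bar>x\<bar> = int n" "heron \<bar>z\<bar> \<bar>x\<bar> \<bar>y\<bar> = int n"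
    by (simp_all add: heron_def)
  moreover consider "\<bar>y\<bar> \<le> \<bar>x\<bar>" "\<bar>z\<bar> \<le> \<bar>x\<bar>" | "\<bar>z\<bar> \<le> \<bar>y\<bar>" "\<bar>x\<bar> \<le> \<bar>y\<bar>"
    | "\<bar>x\<bar> \<le> \<bar>z\<bar>" "\<bar>y\<bar> \<le> \<bar>z\<bar>" by linarith
  then have "heron \<bar>x\<bar> \<bar>y\<bar> \<bar>z\<bar> \<noteq> int n \<or> heron \<bar>y\<bar> \<bar>z\<bar> \<bar>x\<bar> \<noteq> int n \<or> heron \<bar>z\<bar> \<bar>x\<bar> \<bar>y\<bar> \<noteq> int n"
  proof cases
    case 1
    then show ?thesis using heron_dominant_neq[OF assms(2,1) abs_ge_zero _ abs_ge_zero] by blast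
  next
    case 2
    then show ?thesis using heron_dominant_neq[OF assms(2,1) abs_ge_zero _ abs_ge_zero] by blast
  next
    case 3
    then show ?thesis using heron_dominant_neq[OF assms(2,1) abs_ge_zero _ abs_ge_zero] by blast
  qed
  ultimately show False using abs by blast
qed

end
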